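(* For all real $x$ with $0\le x\le \frac{\pi}{2}$ one has $$\frac{2}{\pi}+\frac{2(\pi-2)}{\pi^2}\left(x-\frac{\pi}{2}\right)\le \frac{\tan\frac{x}{2}}{x}\le \frac{4-\pi}{\pi^2}\cdot x+\frac12 .$$
   Context: At $x=0$ the expression $\frac{\tan (x/2)}{x}$ is interpreted as its limit $\frac12$. *)

theory Defs
  imports "HOL-Analysis.Analysis"
begin

text \<open>Division by zero yields 0 in HOL, so the value at 0 has to be given explicitly;
  the lemma below shows that it is the limit of the quotient.\<close>

definition tan_half_quot :: "real \<Rightarrow> real" where
  "tan_half_quot x = (if x = 0 then 1/2 else tan (x/2) / x)"

lemma tan_half_quot_limit: "((\<lambda>x::real. tan (x/2) / x) \<longlongrightarrow> tan_half_quot 0) (at 0)"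
proof -
  have "((\<lambda>x::real. tan (x/2)) has_real_derivative 1/2) (at 0)"
    by (auto intro!: derivative_eq_intros)
  then show ?thesis
    by (simp add: has_field_derivative_iff tan_half_quot_def)
qed

end

theory Submission
  imports Defs
begin

text \<open>With \<open>t = x / 2\<close> and \<open>g t = tan t / t\<close>, the lower bound is half the tangent line of \<open>g\<close> at
  \<open>pi / 4\<close>, and the upper bound is half the chord of \<open>g\<close> over \<open>[0, pi / 4]\<close>. The tangent bound
  follows from \<open>g'' \<ge> 0\<close>. The chord bound says that \<open>(g t - 1) / t\<close> is at most its value at
  \<open>pi / 4\<close>, so it suffices that this slope is nondecreasing; this form avoids differentiating
  at \<open>0\<close>. The numerators of the derivatives involved vanish at \<open>0\<close> and are nondecreasing.\<close>

text \<open>Writing the derivative as \<open>1 + (tan t)\<^sup>2\<close> keeps all later derivatives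
  rational in \<open>t\<close> and \<open>tan t\<close>, so checking them is pure algebra.\<close>

lemma has_real_derivative_tan:
  fixes t :: real
  assumes "0 \<le> t" and "t < pi / 2"
  shows "(tan has_real_derivative 1 + (tan t)\<^sup>2) (at t)"
proof -
  have "cos t \<noteq> 0"
    using cos_gt_zero_pi[of t] assms by simp
  then show ?thesis
    using DERIV_tan[of t] by (simp add: tan_sec power_inverse)
qed

lemma tan_nonneg:
  fixes t :: real
  assumes "0 \<le> t" and "t < pi / 2"
  shows "0 \<le> tan t"
  using assms tan_gt_zero[of t] by (cases "t = 0") auto

lemma nonneg_if_deriv_nonneg:
  fixes f f' :: "real \<Rightarrow> real"
  assumes "f 0 = 0" and "0 \<le> t"
    and "\<And>u. 0 \<le> u \<Longrightarrow> u \<le> t \<Longrightarrow> (f has_real_derivative f' u) (at u)"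
    and "\<And>u. 0 \<le> u \<Longrightarrow> u \<le> t \<Longrightarrow> 0 \<le> f' u"
  shows "0 \<le> f t"
  using DERIV_nonneg_imp_nondecreasing[of 0 t f] assms by fastforce

text \<open>This is the numerator of the derivative of \<open>tan t / t\<close>. Differentiating it
  cancels the two copies of \<open>1 + (tan t)\<^sup>2\<close> and leaves a product of nonnegative
  factors.\<close>

lemma tan_le_mult_sec_square:
  fixes t :: real
  assumes "0 \<le> t" and "t < pi / 2"
  shows "0 \<le> t * (1 + (tan t)\<^sup>2) - tan t"
proof (rule nonneg_if_deriv_nonneg[where t = t and f = "\<lambda>t. t * (1 + (tan t)\<^sup>2) - tan t"
    and f' = "\<lambda>u. 2 * u * tan u * (1 + (tan u)\<^sup>2)"])
  fix u assume u: "0 \<le> u" "u \<le> t"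
  with assms have u': "u < pi / 2" by simp
  note [derivative_intros] = has_real_derivative_tan[OF u(1) u']
  show "((\<lambda>t. t * (1 + (tan t)\<^sup>2) - tan t) has_real_derivative
      2 * u * tan u * (1 + (tan u)\<^sup>2)) (at u)"
    by (auto intro!: derivative_eq_intros simp: algebra_simps power2_eq_square)
  show "0 \<le> 2 * u * tan u * (1 + (tan u)\<^sup>2)"
    using u tan_nonneg[OF u(1) u'] by simp
qed (use assms in auto)

text \<open>Divided by \<open>t ^ 3\<close>, this is the derivative of the slope
  \<open>(tan t - t) / t\<^sup>2\<close>. Its own derivative is
  \<open>tan u * (2 * u * (1 + (tan u)\<^sup>2) - tan u)\<close>, split below so that
  \<open>tan_le_mult_sec_square\<close> applies.\<close>

lemma tan_slope_deriv_numerator_nonneg: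
  fixes t :: real
  assumes "0 \<le> t" and "t < pi / 2"
  shows "0 \<le> t * (1 + (tan t)\<^sup>2) + t - 2 * tan t"
proof (rule nonneg_if_deriv_nonneg[where t = t
    and f = "\<lambda>t. t * (1 + (tan t)\<^sup>2) + t - 2 * tan t"
    and f' = "\<lambda>u. tan u * ((u * (1 + (tan u)\<^sup>2) - tan u) + u * (1 + (tan u)\<^sup>2))"])
  fix u assume u: "0 \<le> u" "u \<le> t"
  with assms have u': "u < pi / 2" by simp
  note [derivative_intros] = has_real_derivative_tan[OF u(1) u']
  show "((\<lambda>t. t * (1 + (tan t)\<^sup>2) + t - 2 * tan t) has_real_derivative
      tan u * ((u * (1 + (tan u)\<^sup>2) - tan u) + u * (1 + (tan u)\<^sup>2))) (at u)"
    by (auto intro!: derivative_eq_intros simp: algebra_simps power2_eq_square)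
  show "0 \<le> tan u * ((u * (1 + (tan u)\<^sup>2) - tan u) + u * (1 + (tan u)\<^sup>2))"
    using u tan_nonneg[OF u(1) u'] tan_le_mult_sec_square[OF u(1) u']
    by (intro mult_nonneg_nonneg add_nonneg_nonneg) auto
qed (use assms in auto)

text \<open>Divided by \<open>t ^ 3\<close>, this is the second derivative of
  \<open>tan t / t\<close>. In its derivative the terms
  \<open>4 * u * tan u * (1 + (tan u)\<^sup>2)\<close> and \<open>2 * (1 + (tan u)\<^sup>2)\<close>
  cancel, and what remains is visibly nonnegative.\<close>

lemma tan_quot_deriv2_numerator_nonneg:
  fixes t :: real
  assumes "0 \<le> t" and "t < pi / 2"
  shows "0 \<le> 2 * t\<^sup>2 * tan t * (1 + (tan t)\<^sup>2) - 2 * t * (1 + (tan t)\<^sup>2) + 2 * tan t"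
proof (rule nonneg_if_deriv_nonneg[where t = t
    and f = "\<lambda>t. 2 * t\<^sup>2 * tan t * (1 + (tan t)\<^sup>2) - 2 * t * (1 + (tan t)\<^sup>2) + 2 * tan t"
    and f' = "\<lambda>u. 2 * u\<^sup>2 * (1 + (tan u)\<^sup>2) * (1 + 3 * (tan u)\<^sup>2)"])
  fix u assume u: "0 \<le> u" "u \<le> t"
  with assms have u': "u < pi / 2" by simp
  note [derivative_intros] = has_real_derivative_tan[OF u(1) u']
  show "((\<lambda>t. 2 * t\<^sup>2 * tan t * (1 + (tan t)\<^sup>2) - 2 * t * (1 + (tan t)\<^sup>2) + 2 * tan t)
      has_real_derivative 2 * u\<^sup>2 * (1 + (tan u)\<^sup>2) * (1 + 3 * (tan u)\<^sup>2)) (at u)"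
    by (auto intro!: derivative_eq_intros simp: algebra_simps power2_eq_square)
qed (use assms in auto)

lemma tan_quot_ge_tangent:
  fixes t s :: real
  assumes "0 < t" "t < pi / 2" and "0 < s" "s < pi / 2"
  shows "tan s / s + (s * (1 + (tan s)\<^sup>2) - tan s) / s\<^sup>2 * (t - s) \<le> tan t / t"
proof -
  have "(s * (1 + (tan s)\<^sup>2) - tan s) / s\<^sup>2 * (t - s) \<le> tan t / t - tan s / s"
  \<comment> \<open>A nonnegative second derivative on a convex set puts the graph above its
    tangents; the open interval avoids the singular quotient at 0.\<close>
  proof (rule f''_imp_f'[where C = "{0<..<pi/2}" and f = "\<lambda>t. tan t / t"
        and f' = "\<lambda>u. (u * (1 + (tan u)\<^sup>2) - tan u) / u\<^sup>2"
        and f'' = "\<lambda>t. (2 * t\<^sup>2 * tan t * (1 + (tan t)\<^sup>2) - 2 * t * (1 + (tan t)\<^sup>2)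
          + 2 * tan t) / t ^ 3"])
    fix u :: real assume "u \<in> {0<..<pi/2}"
    then have u: "0 < u" "0 \<le> u" "u < pi / 2" by auto
    note [derivative_intros] = has_real_derivative_tan[OF u(2,3)]
    show "((\<lambda>t. tan t / t) has_real_derivative (u * (1 + (tan u)\<^sup>2) - tan u) / u\<^sup>2) (at u)"
      using u by (auto intro!: derivative_eq_intros simp: divide_simps)
        (simp add: algebra_simps power2_eq_square)
    show "((\<lambda>u. (u * (1 + (tan u)\<^sup>2) - tan u) / u\<^sup>2) has_real_derivative
        (2 * u\<^sup>2 * tan u * (1 + (tan u)\<^sup>2) - 2 * u * (1 + (tan u)\<^sup>2) + 2 * tan u) / u ^ 3) (at u)"
      using u by (auto intro!: derivative_eq_intros simp: divide_simps)
        (simp add: algebra_simps power2_eq_square power3_eq_cube power4_eq_xxxx)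
    show "0 \<le> (2 * u\<^sup>2 * tan u * (1 + (tan u)\<^sup>2) - 2 * u * (1 + (tan u)\<^sup>2) + 2 * tan u) / u ^ 3"
      using u tan_quot_deriv2_numerator_nonneg[OF u(2,3)] by simp
  qed (use assms in auto)
  then show ?thesis by simp
qed

text \<open>The quantity compared is \<open>(tan t / t - 1) / t\<close>, the slope of the chord of
  \<open>tan t / t\<close> from its limit point \<open>(0, 1)\<close>.\<close>

lemma tan_slope_mono:
  fixes t s :: real
  assumes "0 < t" "t \<le> s" "s < pi / 2"
  shows "(tan t - t) / t\<^sup>2 \<le> (tan s - s) / s\<^sup>2"
proof (rule DERIV_nonneg_imp_nondecreasing[OF assms(2)])
  fix u assume "t \<le> u" "u \<le> s"
  then have u: "0 < u" "0 \<le> u" "u < pi / 2" using assms by auto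
  note [derivative_intros] = has_real_derivative_tan[OF u(2,3)]
  have "((\<lambda>t. (tan t - t) / t\<^sup>2) has_real_derivative
      (u * (1 + (tan u)\<^sup>2) + u - 2 * tan u) / u ^ 3) (at u)"
    using u by (auto intro!: derivative_eq_intros simp: divide_simps)
      (simp add: algebra_simps power2_eq_square power3_eq_cube power4_eq_xxxx)
  moreover have "0 \<le> (u * (1 + (tan u)\<^sup>2) + u - 2 * tan u) / u ^ 3"
    using u tan_slope_deriv_numerator_nonneg[OF u(2,3)] by simp
  ultimately show "\<exists>y. ((\<lambda>t. (tan t - t) / t\<^sup>2) has_real_derivative y) (at u) \<and> 0 \<le> y"
    by blast
qed

theorem theorem6:
  fixes x :: real
  assumes "0 \<le> x" and "x \<le> pi / 2"
  shows "2 / pi + 2 * (pi - 2) / pi\<^sup>2 * (x - pi / 2) \<le> tan_half_quot x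
       \<and> tan_half_quot x \<le> (4 - pi) / pi\<^sup>2 * x + 1 / 2"
proof (cases "x = 0")
  case True
  \<comment> \<open>At 0 the upper bound is an equality, and the lower one amounts to
    \<open>pi \<ge> 8 / 3\<close>.\<close>
  have "2 / pi + 2 * (pi - 2) / pi\<^sup>2 * (0 - pi / 2) = 4 / pi - 1"
    by (simp add: field_simps power2_eq_square)
  also have "\<dots> \<le> 1 / 2"
    using pi_approx by (simp add: field_simps)
  finally show ?thesis
    using True by (simp add: tan_half_quot_def)
next
  case False
  define t where "t = x / 2"
  have t: "0 < t" "t \<le> pi / 4" and x: "x = 2 * t"
    using False assms by (auto simp: t_def)
  have q: "tan_half_quot x = tan t / t / 2"
    using t by (simp add: tan_half_quot_def x)
  \<comment> \<open>Since \<open>tan (pi / 4) = 1\<close>, the quotient at \<open>pi / 4\<close> is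
    \<open>4 / pi\<close>, and its derivative there is
    \<open>(pi / 4 * 2 - 1) / (pi / 4)\<^sup>2\<close>.\<close>
  have lower: "4 / pi + (pi / 2 - 1) * 16 / pi\<^sup>2 * (t - pi / 4) \<le> tan t / t"
    using tan_quot_ge_tangent[of t "pi / 4"] t pi_gt_zero
    by (simp add: tan_45 power_divide)
  have lower_eq: "2 / pi + 2 * (pi - 2) / pi\<^sup>2 * (x - pi / 2)
      = (4 / pi + (pi / 2 - 1) * 16 / pi\<^sup>2 * (t - pi / 4)) / 2"
    by (simp add: x field_simps power2_eq_square)
  have upper: "tan t / t \<le> (1 - pi / 4) * 16 / pi\<^sup>2 * t + 1"
  proof -
    \<comment> \<open>The right side is the slope at \<open>pi / 4\<close>; multiplying by
      \<open>t\<close> turns the slope bound into the chord bound.\<close>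
    have "(tan t - t) / t\<^sup>2 \<le> (1 - pi / 4) * 16 / pi\<^sup>2"
      using tan_slope_mono[of t "pi / 4"] t pi_gt_zero
      by (simp add: tan_45 power_divide)
    then have "(tan t - t) / t\<^sup>2 * t \<le> (1 - pi / 4) * 16 / pi\<^sup>2 * t"
      using t by (intro mult_right_mono) auto
    moreover have "(tan t - t) / t\<^sup>2 * t = tan t / t - 1"
      using t by (simp add: field_simps power2_eq_square)
    ultimately show ?thesis by simp
  qed
  have upper_eq: "(4 - pi) / pi\<^sup>2 * x + 1 / 2 = ((1 - pi / 4) * 16 / pi\<^sup>2 * t + 1) / 2"
    by (simp add: x field_simps power2_eq_square)
  show ?thesis
    unfolding q lower_eq upper_eq
    using lower upper by (intro conjI divide_right_mono) auto
qed

end
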